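(* Let $K$ be a field of characteristic $0$, $n\ge1$, and let $U$ be an associative commutative algebra over $K$ with commuting derivations $\partial_1,\ldots,\partial_n$. Let $\tilde\omega=\mathrm{id}\wedge\partial_1\wedge\cdots\wedge\partial_n$. Then $(U,\tilde\omega)$ is an $(n+1)$-Lie algebra, and it satisfies the identity $f^{\tilde\omega}=0$, i.e. $$\sum_{i=1}^{n+2}(-1)^i\tilde\omega(u_1,\ldots,u_n,v_i)\cdot\tilde\omega(v_1,\ldots,\widehat{v_i},\ldots,v_{n+2})=0$$ for all $u_i,v_j\in U$. If $U$ has a unit $1$, then it satisfies the identity $$\tilde\omega(u\cdot u',u_1,\ldots,u_n)-u\cdot\tilde\omega(u',u_1,\ldots,u_n)-u'\cdot\tilde\omega(u,u_1,\ldots,u_n)=-(u\cdot u')\cdot\tilde\omega(1,u_1,\ldots,u_n)$$ for all $u,u',u_1,\ldots,u_n\in U$.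
   Context: $\tilde\omega(u_0,u_1,\ldots,u_n)$ is the determinant of the $(n+1)\times(n+1)$ matrix whose first row is $(u_0,\ldots,u_n)$ and whose $(i+1)$-st row is $(\partial_iu_0,\ldots,\partial_iu_n)$, $i=1,\ldots,n$. An $m$-Lie algebra $(U,\omega)$ is a vector space with a skew-symmetric $m$-linear map $\omega$ satisfying $$\omega(u_1,\ldots,u_{m-1},\omega(v_1,\ldots,v_m))=\sum_{i=1}^m\omega(v_1,\ldots,v_{i-1},\omega(u_1,\ldots,u_{m-1},v_i),v_{i+1},\ldots,v_m).$$ A hat means omission. *)

theory Defs
  imports Complex_Main "HOL-Combinatorics.Permutations"
begin

(* The algebra need not have a unit, so U is a type of class comm_ring (not comm_ring_1). *)
locale comm_algebra = vector_space scale
  for scale :: "'k::field \<Rightarrow> 'a::comm_ring \<Rightarrow> 'a" +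
  assumes scale_mult_left: "scale c x * y = scale c (x * y)"

definition derivation :: "('k::field \<Rightarrow> 'a::comm_ring \<Rightarrow> 'a) \<Rightarrow> ('a \<Rightarrow> 'a) \<Rightarrow> bool" where
  "derivation scale D \<longleftrightarrow>
     Vector_Spaces.linear scale scale D \<and> (\<forall>x y. D (x * y) = D x * y + x * D y)"

(* The library's prod and det require a unit.  prod_upto f n is f 0 * ... * f n, a nonempty
   product, and det_upto n M is the Leibniz formula for the determinant of the
   (n+1) x (n+1) matrix (M i j), 0 <= i, j <= n. *)
primrec prod_upto :: "(nat \<Rightarrow> 'a::comm_ring) \<Rightarrow> nat \<Rightarrow> 'a" where
  "prod_upto f 0 = f 0"
| "prod_upto f (Suc n) = prod_upto f n * f (Suc n)"

definition det_upto :: "nat \<Rightarrow> (nat \<Rightarrow> nat \<Rightarrow> 'a::comm_ring) \<Rightarrow> 'a" where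
  "det_upto n M = (\<Sum>p | p permutes {..n}.
     if evenperm p then prod_upto (\<lambda>i. M i (p i)) n else - prod_upto (\<lambda>i. M i (p i)) n)"

lemma det_upto_unital:
  fixes M :: "nat \<Rightarrow> nat \<Rightarrow> 'a::comm_ring_1"
  shows "det_upto n M = (\<Sum>p | p permutes {..n}. of_int (sign p) * (\<Prod>i\<le>n. M i (p i)))"
proof -
  have "prod_upto f n = (\<Prod>i\<le>n. f i)" for f :: "nat \<Rightarrow> 'a"
    by (induction n) simp_all
  then show ?thesis
    unfolding det_upto_def by (intro sum.cong) (simp_all add: sign_def)
qed

(* Arguments u_0, ..., u_n are passed as a list of length n + 1; D i is used for 1 <= i <= n. *)
definition omega_tilde :: "nat \<Rightarrow> (nat \<Rightarrow> 'a::comm_ring \<Rightarrow> 'a) \<Rightarrow> 'a list \<Rightarrow> 'a" where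
  "omega_tilde n D us = det_upto n (\<lambda>i j. if i = 0 then us ! j else D i (us ! j))"

(* An m-ary operation is a function on lists, considered only on lists of length m. *)
definition multilinear ::
    "('k::field \<Rightarrow> 'a::ab_group_add \<Rightarrow> 'a) \<Rightarrow> nat \<Rightarrow> ('a list \<Rightarrow> 'a) \<Rightarrow> bool" where
  "multilinear scale m \<omega> \<longleftrightarrow>
     (\<forall>xs i. length xs = m \<longrightarrow> i < m \<longrightarrow>
        Vector_Spaces.linear scale scale (\<lambda>x. \<omega> (xs[i := x])))"

definition skew_symmetric ::
    "('k::field \<Rightarrow> 'a::ab_group_add \<Rightarrow> 'a) \<Rightarrow> nat \<Rightarrow> ('a list \<Rightarrow> 'a) \<Rightarrow> bool" where
  "skew_symmetric scale m \<omega> \<longleftrightarrow>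
     (\<forall>xs p. length xs = m \<longrightarrow> p permutes {..<m} \<longrightarrow>
        \<omega> (permute_list p xs) = scale (of_int (sign p)) (\<omega> xs))"

definition m_Lie_algebra ::
    "('k::field \<Rightarrow> 'a::ab_group_add \<Rightarrow> 'a) \<Rightarrow> nat \<Rightarrow> ('a list \<Rightarrow> 'a) \<Rightarrow> bool" where
  "m_Lie_algebra scale m \<omega> \<longleftrightarrow>
     vector_space scale \<and> multilinear scale m \<omega> \<and> skew_symmetric scale m \<omega> \<and>
     (\<forall>us vs. length us + 1 = m \<longrightarrow> length vs = m \<longrightarrow>
        \<omega> (us @ [\<omega> vs]) = (\<Sum>i<m. \<omega> (vs[i := \<omega> (us @ [vs ! i])])))"

end

(* Adjoin a unit to U and extend each derivation by 0 on the integers. Expanding along the last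
   column, w \<mapsto> \<omega>(u_1, ..., u_n, w) is the first-order operator L = \<Sum>_i c_i \<partial>_i with \<partial>_0 = id and cofactors
   c_i. On columns (\<partial>_0 v, ..., \<partial>_n v), L acts as A + \<Sum>_{i>0} c_i \<partial>_i for a matrix A, so applying L to the
   columns of the matrix of \<omega>(v_0, ..., v_n) one at a time yields

     tr(A) \<omega>(v) + \<Sum>_{i>0} c_i \<partial>_i \<omega>(v),   tr(A) = (n + 1) c_0 + \<Sum>_{i>0} \<partial>_i c_i,

   and this is L \<omega>(v) because of the divergence identity \<Sum>_{i>0} \<partial>_i c_i = - n c_0, in which all second
   derivatives cancel as the \<partial>_i commute. The quadratic identity is the Laplace expansion of a
   determinant with a repeated row, weighted by the c_i, and the last identity holds for every
   first-order operator. *)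

theory Submission
  imports Defs "Jordan_Normal_Form.Determinant"
begin

section \<open>Determinants over a unital ring\<close>

lemma det_upto_cong:
  assumes "\<And>i j. i \<le> n \<Longrightarrow> j \<le> n \<Longrightarrow> M i j = N i j"
  shows "det_upto n M = det_upto n N"
proof -
  have prod: "prod_upto f n = prod_upto g n" if "\<And>i. i \<le> n \<Longrightarrow> f i = g i"
    for f g :: "nat \<Rightarrow> 'a" and n
    using that by (induction n) auto
  have "prod_upto (\<lambda>i. M i (p i)) n = prod_upto (\<lambda>i. N i (p i)) n" if "p permutes {..n}" for p
    using assms permutes_in_image[OF that] by (intro prod) auto
  then show ?thesis
    unfolding det_upto_def by (intro sum.cong) auto
qed

lemma det_upto_eq_det:
  fixes M :: "nat \<Rightarrow> nat \<Rightarrow> 'a::comm_ring_1"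
  shows "det_upto n M = det (mat (Suc n) (Suc n) (\<lambda>(i, j). M i j))"
proof -
  have n: "{0..<Suc n} = {..n}"
    by auto
  have "(\<Prod>i\<le>n. mat (Suc n) (Suc n) (\<lambda>(i, j). M i j) $$ (i, p i)) = (\<Prod>i\<le>n. M i (p i))"
    if "p permutes {..n}" for p
  proof (intro prod.cong refl)
    fix i assume "i \<in> {..n}"
    moreover from this have "p i \<in> {..n}"
      using permutes_in_image[OF that] by blast
    ultimately show "mat (Suc n) (Suc n) (\<lambda>(i, j). M i j) $$ (i, p i) = M i (p i)"
      by simp
  qed
  then show ?thesis
    unfolding det_def'[OF mat_carrier] det_upto_unital n by (intro sum.cong) auto
qed

lemma det_upto_transpose:
  fixes M :: "nat \<Rightarrow> nat \<Rightarrow> 'a::comm_ring_1"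
  shows "det_upto n (\<lambda>i j. M j i) = det_upto n M"
proof -
  have "mat (Suc n) (Suc n) (\<lambda>(i, j). M j i) = (mat (Suc n) (Suc n) (\<lambda>(i, j). M i j))\<^sup>T"
    by auto
  then show ?thesis
    by (simp add: det_upto_eq_det det_transpose[where n = "Suc n"])
qed

lemma det_upto_permute_rows:
  fixes M :: "nat \<Rightarrow> nat \<Rightarrow> 'a::comm_ring_1"
  assumes "p permutes {..n}"
  shows "det_upto n (\<lambda>i j. M (p i) j) = of_int (sign p) * det_upto n M"
proof -
  have p: "p permutes {0..<Suc n}"
    using assms by (simp add: atLeast0LessThan lessThan_Suc_atMost)
  have "mat (Suc n) (Suc n) (\<lambda>(i, j). M (p i) j) =
      mat (Suc n) (Suc n) (\<lambda>(i, j). mat (Suc n) (Suc n) (\<lambda>(i, j). M i j) $$ (p i, j))"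
    using permutes_in_image[OF p] by (intro eq_matI) auto
  then show ?thesis
    unfolding det_upto_eq_det by (metis det_permute_rows[OF mat_carrier p])
qed

lemma det_upto_permute_columns:
  fixes M :: "nat \<Rightarrow> nat \<Rightarrow> 'a::comm_ring_1"
  assumes "p permutes {..n}"
  shows "det_upto n (\<lambda>i j. M i (p j)) = of_int (sign p) * det_upto n M"
  using det_upto_permute_rows[OF assms, of "\<lambda>i j. M j i"]
  unfolding det_upto_transpose[of n M] det_upto_transpose[of n "\<lambda>i j. M i (p j)"] .

lemma det_upto_identical_rows:
  fixes M :: "nat \<Rightarrow> nat \<Rightarrow> 'a::comm_ring_1"
  assumes "k \<le> n" "l \<le> n" "k \<noteq> l" "\<And>j. j \<le> n \<Longrightarrow> M k j = M l j"
  shows "det_upto n M = 0"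
  unfolding det_upto_eq_det
  by (rule det_identical_rows[OF mat_carrier assms(3)]) (use assms in \<open>auto simp: row_def\<close>)

lemma det_upto_row_add:
  fixes M :: "nat \<Rightarrow> nat \<Rightarrow> 'a::comm_ring_1"
  assumes "k \<le> n"
  shows "det_upto n (\<lambda>i j. if i = k then x j + y j else M i j) =
    det_upto n (\<lambda>i j. if i = k then x j else M i j) + det_upto n (\<lambda>i j. if i = k then y j else M i j)"
proof -
  have prod: "(\<Prod>i\<le>n. if i = k then w i else M i (p i)) = w k * (\<Prod>i\<in>{..n} - {k}. M i (p i))" for w p
    using assms by (simp add: prod.remove[of "{..n}" k])
  show ?thesis
    unfolding det_upto_unital prod by (simp add: sum.distrib distrib_left distrib_right)
qed

lemma det_upto_row_sum:
  fixes M :: "nat \<Rightarrow> nat \<Rightarrow> 'a::comm_ring_1"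
  assumes "k \<le> n"
  shows "det_upto n (\<lambda>i j. if i = k then (\<Sum>s\<in>S. a s * x s j) else M i j) =
    (\<Sum>s\<in>S. a s * det_upto n (\<lambda>i j. if i = k then x s j else M i j))"
proof -
  have prod: "(\<Prod>i\<le>n. if i = k then w i else M i (p i)) = w k * (\<Prod>i\<in>{..n} - {k}. M i (p i))" for w p
    using assms by (simp add: prod.remove[of "{..n}" k])
  show ?thesis
    unfolding det_upto_unital sum_distrib_left prod
    by (subst sum.swap) (simp add: sum_distrib_right sum_distrib_left mult_ac)
qed

text \<open>Cofactor expansion: the new column is split into multiples of unit vectors. The
  cofactors stay full-size determinants with a unit column, a form that can be differentiated row by
  row.\<close>

lemma det_upto_column_expand:
  fixes M :: "nat \<Rightarrow> nat \<Rightarrow> 'a::comm_ring_1"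
  assumes "k \<le> n"
  shows "det_upto n (\<lambda>i j. if j = k then w i else M i j) =
    (\<Sum>s\<le>n. w s * det_upto n (\<lambda>i j. if j = k then of_bool (i = s) else M i j))"
proof -
  have "det_upto n (\<lambda>i j. if j = k then w i else M i j) =
      det_upto n (\<lambda>i j. if i = k then (\<Sum>s\<le>n. w s * of_bool (j = s)) else M j i)"
    by (subst det_upto_transpose[symmetric]) (auto intro!: det_upto_cong)
  also have "\<dots> = (\<Sum>s\<le>n. w s * det_upto n (\<lambda>i j. if i = k then of_bool (j = s) else M j i))"
    using assms by (rule det_upto_row_sum)
  also have "\<dots> = (\<Sum>s\<le>n. w s * det_upto n (\<lambda>i j. if j = k then of_bool (i = s) else M i j))"
    by (subst det_upto_transpose[symmetric]) simp
  finally show ?thesis .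
qed

text \<open>In the Leibniz term of \<open>p\<close>, replacing column k or row k alters exactly one
  factor, and over all k each factor is altered once either way. This links operators acting on
  columns with derivations, which act on rows.\<close>

lemma sum_det_upto_replace_column_eq_row:
  fixes M :: "nat \<Rightarrow> nat \<Rightarrow> 'a::comm_ring_1"
  shows "(\<Sum>k\<le>n. det_upto n (\<lambda>i j. if j = k then W i j else M i j)) =
    (\<Sum>k\<le>n. det_upto n (\<lambda>i j. if i = k then W i j else M i j))"
proof -
  have "(\<Sum>k\<le>n. \<Prod>i\<le>n. if p i = k then W i (p i) else M i (p i)) =
      (\<Sum>k\<le>n. \<Prod>i\<le>n. if i = k then W i (p i) else M i (p i))" if p: "p permutes {..n}" for p
    by (subst sum.permute[OF p]) (simp add: inj_eq[OF permutes_inj[OF p]])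
  then show ?thesis
    unfolding det_upto_unital
    by (subst (1 2) sum.swap) (auto intro!: sum.cong simp: sum_distrib_left[symmetric])
qed

text \<open>Put a second copy of row \<open>i\<close> on top of the n+1 rows and expand the
  resulting determinant of size n+2, which is zero, along that copy.\<close>

lemma det_upto_repeated_row_expand:
  fixes M :: "nat \<Rightarrow> nat \<Rightarrow> 'a::comm_ring_1"
  assumes "i \<le> n"
  shows "(\<Sum>j\<le>Suc n. (-1) ^ j * M i j * det_upto n (\<lambda>r c. M r (if c < j then c else Suc c))) = 0"
proof -
  define A where "A = mat (Suc (Suc n)) (Suc (Suc n)) (\<lambda>(r, c). if r = 0 then M i c else M (r - 1) c)"
  have A: "A \<in> carrier_mat (Suc (Suc n)) (Suc (Suc n))"
    by (simp add: A_def)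
  have "A $$ (0, j) * cofactor A 0 j =
      (-1) ^ j * M i j * det_upto n (\<lambda>r c. M r (if c < j then c else Suc c))" if "j \<le> Suc n" for j
  proof -
    have "mat_delete A 0 j = mat (Suc n) (Suc n) (\<lambda>(r, c). M r (if c < j then c else Suc c))"
      by (intro eq_matI) (auto simp: mat_delete_def A_def)
    then show ?thesis
      using that by (simp add: cofactor_def det_upto_eq_det A_def)
  qed
  then have "det A = (\<Sum>j\<le>Suc n. (-1) ^ j * M i j * det_upto n (\<lambda>r c. M r (if c < j then c else Suc c)))"
    unfolding laplace_expansion_row[OF A zero_less_Suc] lessThan_Suc_atMost by (intro sum.cong) auto
  moreover have "det A = 0"
    by (rule det_identical_rows[OF A, of 0 "Suc i"]) (use assms in \<open>auto simp: A_def\<close>)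
  ultimately show ?thesis
    by simp
qed

text \<open>Column \<open>l\<close> vanishes outside row \<open>k\<close>, so a nonzero Leibniz term
  has \<open>p k = l\<close> and meets row \<open>k\<close> only there.\<close>

lemma det_upto_unit_column_cong:
  fixes M N :: "nat \<Rightarrow> nat \<Rightarrow> 'a::comm_ring_1"
  assumes "k \<le> n" "l \<le> n"
    and eq: "\<And>i j. i \<le> n \<Longrightarrow> j \<le> n \<Longrightarrow> i \<noteq> k \<or> j = l \<Longrightarrow> M i j = N i j"
    and zero: "\<And>i. i \<le> n \<Longrightarrow> i \<noteq> k \<Longrightarrow> M i l = 0"
  shows "det_upto n M = det_upto n N"
proof -
  have "(\<Prod>i\<le>n. M i (p i)) = (\<Prod>i\<le>n. N i (p i))" if p: "p permutes {..n}" for p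
  proof (cases "p k = l")
    case True
    have "p i \<le> n" if "i \<le> n" for i
      using permutes_in_image[OF p, of i] that by simp
    with True show ?thesis
      by (intro prod.cong refl eq) auto
  next
    case False
    obtain i where i: "p i = l" "i \<le> n"
      using permutes_image[OF p] \<open>l \<le> n\<close> by (metis atMost_iff imageE)
    with False have "i \<noteq> k"
      by auto
    then have "M i (p i) = 0" "N i (p i) = 0"
      using zero[of i] eq[of i l] i \<open>l \<le> n\<close> by auto
    then show ?thesis
      using i(2) by (metis atMost_iff finite_atMost prod_zero)
  qed
  then show ?thesis
    unfolding det_upto_unital by (intro sum.cong) auto
qed

section \<open>Derivations of products and determinants\<close>

lemma derivation_prod:
  fixes d :: "'a::comm_ring_1 \<Rightarrow> 'a"
  assumes d: "\<And>x y. d (x * y) = d x * y + x * d y" and "finite I"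
  shows "d (\<Prod>i\<in>I. f i) = (\<Sum>k\<in>I. \<Prod>i\<in>I. if i = k then d (f i) else f i)"
  using \<open>finite I\<close>
proof induction
  case empty
  \<comment> \<open>The Leibniz rule for 1 * 1 forces \<open>d 1 = 0\<close>.\<close>
  show ?case using d[of 1 1] by simp
next
  case (insert a I)
  have "(\<Prod>i\<in>I. if i = a then d (f i) else f i) = (\<Prod>i\<in>I. f i)"
    using insert.hyps by (intro prod.cong) auto
  moreover have "(\<Sum>k\<in>I. \<Prod>i\<in>insert a I. if i = k then d (f i) else f i) =
      f a * (\<Sum>k\<in>I. \<Prod>i\<in>I. if i = k then d (f i) else f i)"
    using insert.hyps by (auto simp: sum_distrib_left intro!: sum.cong)
  ultimately show ?case
    using insert by (simp add: d)
qed

lemma derivation_det_upto: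
  fixes d :: "'a::comm_ring_1 \<Rightarrow> 'a"
  assumes add: "\<And>x y. d (x + y) = d x + d y" and mult: "\<And>x y. d (x * y) = d x * y + x * d y"
  shows "d (det_upto n M) = (\<Sum>k\<le>n. det_upto n (\<lambda>i j. if i = k then d (M i j) else M i j))"
proof -
  interpret d: additive d
    by unfold_locales (rule add)
  have "d (of_int (sign p) * x) = of_int (sign p) * d x" for p :: "nat \<Rightarrow> nat" and x
    by (cases p rule: sign_cases) (simp_all add: d.minus)
  then show ?thesis
    unfolding det_upto_unital
    by (subst sum.swap) (simp add: d.sum derivation_prod[OF mult] sum_distrib_left)
qed

lemma sum_atMost_eq_0_plus:
  fixes f :: "nat \<Rightarrow> 'a::comm_monoid_add"
  shows "(\<Sum>i\<le>n. f i) = f 0 + (\<Sum>i=1..n. f i)"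
proof -
  have "{..n} = insert 0 {1..n}"
    by auto
  then show ?thesis
    by simp
qed

text \<open>A new index contributes a row and a column that cancel, and a zero diagonal entry. The
  induction avoids dividing by 2, which an arbitrary abelian group does not allow.\<close>

lemma sum_antisymmetric:
  fixes X :: "'b \<Rightarrow> 'b \<Rightarrow> 'a::ab_group_add"
  assumes "finite S" "\<And>r. r \<in> S \<Longrightarrow> X r r = 0" "\<And>r k. r \<in> S \<Longrightarrow> k \<in> S \<Longrightarrow> r \<noteq> k \<Longrightarrow> X r k = - X k r"
  shows "(\<Sum>r\<in>S. \<Sum>k\<in>S. X r k) = 0"
  using assms
proof induction
  case empty
  show ?case by simp
next
  case (insert a S)
  have "(\<Sum>r\<in>S. X r a) = (\<Sum>r\<in>S. - X a r)"
    using insert.hyps by (intro sum.cong refl insert.prems(2)) auto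
  moreover have "(\<Sum>r\<in>S. \<Sum>k\<in>S. X r k) = 0"
    by (intro insert.IH insert.prems) auto
  ultimately show ?case
    using insert.hyps insert.prems(1)[of a] by (simp add: sum.distrib sum_negf)
qed

section \<open>The generalized Wronskian-Jacobian over a unital ring\<close>

text \<open>The axioms are purely ring-theoretic, to fit the unitization below, on which only the
  integers act.\<close>

locale commuting_derivations =
  fixes n :: nat and D :: "nat \<Rightarrow> 'a::comm_ring_1 \<Rightarrow> 'a"
  assumes D_add: "i \<in> {1..n} \<Longrightarrow> D i (x + y) = D i x + D i y"
    and D_mult: "i \<in> {1..n} \<Longrightarrow> D i (x * y) = D i x * y + x * D i y"
    and D_commute: "i \<in> {1..n} \<Longrightarrow> j \<in> {1..n} \<Longrightarrow> D i (D j x) = D j (D i x)"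
begin

definition E :: "nat \<Rightarrow> 'a \<Rightarrow> 'a" where
  "E i x = (if i = 0 then x else D i x)"

text \<open>The arguments form a sequence read up to index n, so that replacing one of them is a
  function update.\<close>

definition jac :: "(nat \<Rightarrow> 'a) \<Rightarrow> 'a" where
  "jac v = det_upto n (\<lambda>i j. E i (v j))"

text \<open>The cofactor at row \<open>s\<close> and column \<open>k\<close>; for
  \<open>k = n\<close> these are the coefficients c_s of the operator L.\<close>

definition cof :: "(nat \<Rightarrow> 'a) \<Rightarrow> nat \<Rightarrow> nat \<Rightarrow> 'a" where
  "cof v k s = det_upto n (\<lambda>i j. if j = k then of_bool (i = s) else E i (v j))"

lemma E_0 [simp]: "E 0 x = x"
  by (simp add: E_def)

lemma E_eq_D: "i \<in> {1..n} \<Longrightarrow> E i x = D i x"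
  by (simp add: E_def)

lemma E_commute: "i \<le> n \<Longrightarrow> j \<le> n \<Longrightarrow> E i (E j x) = E j (E i x)"
  using D_commute[of i j x] by (auto simp: E_def)

lemma D_0: "i \<in> {1..n} \<Longrightarrow> D i 0 = 0"
  using D_add[of i 0 0] by simp

lemma D_1: "i \<in> {1..n} \<Longrightarrow> D i 1 = 0"
  using D_mult[of i 1 1] by simp

lemma D_of_bool: "i \<in> {1..n} \<Longrightarrow> D i (of_bool b) = 0"
  by (cases b) (simp_all add: D_0 D_1)

lemma D_sum:
  assumes "i \<in> {1..n}"
  shows "D i (\<Sum>s\<in>S. f s) = (\<Sum>s\<in>S. D i (f s))"
  using assms by (induction S rule: infinite_finite_induct) (simp_all add: D_0 D_add)

lemma D_det_upto:
  assumes "i \<in> {1..n}"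
  shows "D i (det_upto m M) = (\<Sum>k\<le>m. det_upto m (\<lambda>r j. if r = k then D i (M r j) else M r j))"
  using assms by (intro derivation_det_upto D_add D_mult)

lemma jac_cong:
  assumes "\<And>j. j \<le> n \<Longrightarrow> v j = w j"
  shows "jac v = jac w"
  unfolding jac_def using assms by (intro det_upto_cong) simp

lemma jac_permute:
  assumes "p permutes {..n}"
  shows "jac (v \<circ> p) = of_int (sign p) * jac v"
  unfolding jac_def comp_def using assms by (rule det_upto_permute_columns)

lemma jac_update:
  assumes "k \<le> n"
  shows "jac (v(k := w)) = (\<Sum>s\<le>n. cof v k s * E s w)"
proof -
  have "jac (v(k := w)) = det_upto n (\<lambda>i j. if j = k then E i w else E i (v j))"
    unfolding jac_def by (intro det_upto_cong) auto
  also have "\<dots> = (\<Sum>s\<le>n. E s w * cof v k s)"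
    unfolding cof_def using assms by (rule det_upto_column_expand)
  finally show ?thesis
    by (simp add: mult.commute)
qed

text \<open>In the matrices \<open>C r\<close> below the last column is the unit vector at \<open>r\<close>, so that row \<open>r\<close> may be
  changed freely in the other columns. After exchanging two rows, differentiating row \<open>k\<close> of \<open>C r\<close>
  by \<open>D r\<close> therefore gives the same matrix as differentiating row \<open>r\<close> of \<open>C k\<close> by \<open>D k\<close>.\<close>

lemma divergence_cof: "(\<Sum>r = 1..n. D r (cof u n r)) = - of_nat n * cof u n 0"
proof -
  define C where "C r i j = (if j = n then of_bool (i = r) else E i (u j))" for r i j
  define X where "X r k = det_upto n (\<lambda>i j. if i = k then D r (C r i j) else C r i j)" for r k
  have antisym: "X r k = - X k r" if "r \<in> {1..n}" "k \<in> {1..n}" "r \<noteq> k" for r k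
  proof -
    let ?p = "Transposition.transpose r k"
    have "X r k = det_upto n (\<lambda>i j. if ?p i = r then D k (C k (?p i) j) else C k (?p i) j)"
      unfolding X_def
    proof (rule det_upto_unit_column_cong[of r n n], goal_cases)
      case (3 i j)
      then show ?case
        using that D_commute[of r k "u j"]
        by (auto simp: C_def D_of_bool D_0 E_eq_D Transposition.transpose_def)
    qed (use that in \<open>auto simp: C_def D_0\<close>)
    also have "\<dots> = - X k r"
      unfolding X_def using that
      by (subst det_upto_permute_rows[where p = ?p]) (auto simp: sign_swap_id permutes_swap_id)
    finally show ?thesis .
  qed
  \<comment> \<open>\<open>D r\<close> kills the single 1 in the last column, which leaves a zero
    column.\<close>
  have diag: "X r r = 0" if "r \<in> {1..n}" for r
  proof -
    have "X r r = det_upto n (\<lambda>i j. if j = n then 0 else if i = r then D r (C r i j) else C r i j)"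
      unfolding X_def using that by (intro det_upto_cong) (auto simp: C_def D_1)
    also have "\<dots> = 0"
      by (subst det_upto_column_expand) simp_all
    finally show ?thesis .
  qed
  have *: "(\<Sum>r = 1..n. \<Sum>k = 1..n. X r k) = 0"
    by (rule sum_antisymmetric[OF finite_atLeastAtMost diag antisym])
  \<comment> \<open>Applying \<open>D r\<close> to row 0 produces the row that \<open>C 0\<close>
    has at \<open>r\<close>. Row \<open>r\<close> carries the unit, so its other entries may be
    taken from row 0 of \<open>C 0\<close>; undoing the exchange of the two rows gives the
    sign.\<close>
  have X_0: "X r 0 = - cof u n 0" if "r \<in> {1..n}" for r
  proof -
    let ?p = "Transposition.transpose 0 r"
    have "X r 0 = det_upto n (\<lambda>i j. C 0 (?p i) j)"
      unfolding X_def
    proof (rule det_upto_unit_column_cong[of r n n], goal_cases)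
      case (3 i j)
      then show ?case
        using that by (auto simp: C_def D_of_bool D_0 E_eq_D Transposition.transpose_def)
    qed (use that in \<open>auto simp: C_def D_0\<close>)
    also have "\<dots> = - cof u n 0"
      unfolding cof_def C_def using that
      by (subst det_upto_permute_rows[where p = ?p]) (auto simp: sign_swap_id permutes_swap_id)
    finally show ?thesis .
  qed
  \<comment> \<open>The terms with k > 0 cancel by antisymmetry, and each of the n values of r
    leaves the term with k = 0.\<close>
  have "(\<Sum>r = 1..n. D r (cof u n r)) = (\<Sum>r = 1..n. \<Sum>k\<le>n. X r k)"
    unfolding X_def C_def cof_def by (intro sum.cong refl) (simp add: D_det_upto)
  also have "\<dots> = (\<Sum>r = 1..n. - cof u n 0)"
    unfolding sum_atMost_eq_0_plus sum.distrib * using X_0 by simp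
  finally show ?thesis
    by simp
qed

text \<open>For distinct \<open>i\<close> and \<open>r\<close> a row occurs twice. Hence replacing
  row \<open>r\<close> by a combination of rows retains only its diagonal coefficient, which is how
  a trace arises.\<close>

lemma jac_replace_row:
  assumes "r \<le> n" "i \<le> n"
  shows "det_upto n (\<lambda>k j. if k = r then E i (v j) else E k (v j)) = of_bool (i = r) * jac v"
proof (cases "i = r")
  case True
  then show ?thesis
    unfolding jac_def by (auto intro!: det_upto_cong)
next
  case False
  then show ?thesis
    using assms by (simp add: det_upto_identical_rows[of r n i])
qed

lemma jac_Filippov:
  "jac (u(n := jac v)) = (\<Sum>k\<le>n. jac (v(k := jac (u(n := v k)))))"
proof -
  let ?c = "cof u n"
  let ?row = "\<lambda>r x. det_upto n (\<lambda>i j. if i = r then x j else E i (v j))"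
  define L where "L w = (\<Sum>s\<le>n. ?c s * E s w)" for w
  have L: "jac (u(n := w)) = L w" for w
    by (simp add: jac_update L_def)
  \<comment> \<open>Product rule for L: the coefficients are differentiated in the first sum, and
    commutation moves \<open>E s\<close> outside in the second. For r = 0 nothing is
    differentiated.\<close>
  have E_L: "E r (L w) = (\<Sum>s\<le>n. (if r = 0 then 0 else D r (?c s)) * E s w) + (\<Sum>s\<le>n. ?c s * E s (E r w))"
    if "r \<le> n" for r w
  proof (cases "r = 0")
    case False
    then have r: "r \<in> {1..n}"
      using that by simp
    have "D r (?c s * E s w) = D r (?c s) * E s w + ?c s * E s (D r w)" if "s \<le> n" for s
      using E_commute[of r s w] r that by (simp add: D_mult E_eq_D)
    with r show ?thesis
      unfolding L_def by (simp add: E_eq_D D_sum sum.distrib[symmetric])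
  qed (simp add: L_def)
  have rows: "?row r (\<lambda>j. E r (L (v j))) =
      (if r = 0 then 0 else D r (?c r)) * jac v + (\<Sum>s\<le>n. ?c s * ?row r (\<lambda>j. E s (E r (v j))))"
    if "r \<le> n" for r
    unfolding E_L[OF that] det_upto_row_add[OF that] det_upto_row_sum[OF that]
    using that by (simp add: jac_replace_row[OF that] of_bool_def if_distrib[where f = "\<lambda>x. _ * x"] if_distrib[where f = "\<lambda>x. x * _"] cong: if_cong)
  have "(\<Sum>k\<le>n. jac (v(k := L (v k)))) = (\<Sum>k\<le>n. det_upto n (\<lambda>i j. if j = k then E i (L (v j)) else E i (v j)))"
    unfolding jac_def by (intro sum.cong refl det_upto_cong) auto
  \<comment> \<open>Columns are traded for rows, because \<open>E_L\<close> describes the entries of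
    one row uniformly in j.\<close>
  also have "\<dots> = (\<Sum>r\<le>n. ?row r (\<lambda>j. E r (L (v j))))"
    unfolding sum_det_upto_replace_column_eq_row
    by (intro sum.cong refl det_upto_cong) auto
  also have "\<dots> = (\<Sum>r = 1..n. D r (?c r)) * jac v + (\<Sum>r\<le>n. \<Sum>s\<le>n. ?c s * ?row r (\<lambda>j. E s (E r (v j))))"
    by (simp add: rows sum.distrib sum_distrib_right sum_atMost_eq_0_plus)
  also have "(\<Sum>r\<le>n. \<Sum>s\<le>n. ?c s * ?row r (\<lambda>j. E s (E r (v j)))) =
      (\<Sum>s\<le>n. ?c s * (\<Sum>r\<le>n. ?row r (\<lambda>j. E s (E r (v j)))))"
    by (subst sum.swap) (simp add: sum_distrib_left)
  \<comment> \<open>For s = 0 every row replacement is trivial, giving n+1 copies of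
    \<open>jac v\<close>; for s > 0 the sum over r is the row-wise derivative of
    \<open>jac v\<close>.\<close>
  also have "\<dots> = ?c 0 * (of_nat (Suc n) * jac v) + (\<Sum>s = 1..n. ?c s * D s (jac v))"
  proof -
    have "?row r (\<lambda>j. E 0 (E r (v j))) = jac v" for r
      unfolding jac_def by (intro det_upto_cong) auto
    then have "(\<Sum>r\<le>n. ?row r (\<lambda>j. E 0 (E r (v j)))) = of_nat (Suc n) * jac v"
      by simp
    moreover have "(\<Sum>r\<le>n. ?row r (\<lambda>j. E s (E r (v j)))) = D s (jac v)" if "s \<in> {1..n}" for s
      using that unfolding jac_def
      by (simp only: D_det_upto E_eq_D) (intro sum.cong refl det_upto_cong, auto)
    ultimately show ?thesis
      unfolding sum_atMost_eq_0_plus[where f = "\<lambda>s. ?c s * _ s"] by simp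
  qed
  \<comment> \<open>The divergence -n c_0 lowers the coefficient (n+1) c_0 to c_0, as L
    requires.\<close>
  also have "(\<Sum>r = 1..n. D r (?c r)) * jac v + (?c 0 * (of_nat (Suc n) * jac v) + (\<Sum>s = 1..n. ?c s * D s (jac v))) = L (jac v)"
    unfolding divergence_cof L_def sum_atMost_eq_0_plus by (simp add: E_eq_D algebra_simps)
  finally show ?thesis
    unfolding L by (rule sym)
qed

lemma jac_quadratic:
  "(\<Sum>j\<le>Suc n. (-1) ^ j * (jac (u(n := v j)) * jac (\<lambda>c. v (if c < j then c else Suc c)))) = 0"
proof -
  \<comment> \<open>Expand the first factor along its last column and exchange sums; for each s the
    inner sum is an expansion with row s repeated.\<close>
  have "(\<Sum>j\<le>Suc n. (-1) ^ j * (jac (u(n := v j)) * jac (\<lambda>c. v (if c < j then c else Suc c)))) =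
      (\<Sum>s\<le>n. cof u n s * (\<Sum>j\<le>Suc n. (-1) ^ j * E s (v j) * jac (\<lambda>c. v (if c < j then c else Suc c))))"
    unfolding jac_update[OF order_refl] sum_distrib_left sum_distrib_right
    by (subst sum.swap) (simp only: mult_ac)
  also have "\<dots> = 0"
    using det_upto_repeated_row_expand[where M = "\<lambda>r c. E r (v c)"]
    unfolding jac_def by (intro sum.neutral ballI) (simp del: sum.atMost_Suc)
  finally show ?thesis .
qed

text \<open>The first-order terms cancel by the Leibniz rule, and the zeroth-order ones leave c_0 -
  2 c_0 = -c_0 times a a'. The unit of U is not the unit of the unitization, so \<open>e\<close> is
  only asked to fix \<open>a\<close> and \<open>a'\<close>.\<close>

lemma jac_mult:
  assumes "\<And>x. x \<in> {a, a'} \<Longrightarrow> e * x = x"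
  shows "jac (v(0 := a * a')) - a * jac (v(0 := a')) - a' * jac (v(0 := a)) = - (a * a' * jac (v(0 := e)))"
proof -
  \<comment> \<open>Differentiate e a = a, multiply by a', and use e a' = a' to cancel.\<close>
  have D_e: "a * a' * D s e = 0" if "s \<in> {1..n}" for s
  proof -
    have "D s a = D s e * a + e * D s a"
      using D_mult[OF that, of e a] assms[of a] by simp
    then have "a' * D s a = a * a' * D s e + (e * a') * D s a"
      by (metis (no_types, lifting) distrib_left mult.assoc mult.commute)
    then show ?thesis
      using assms[of a'] by simp
  qed
  have "a * a' * e = a * a'"
    using assms[of a] by (metis insertI1 mult.assoc mult.commute)
  moreover have "a * a' * (\<Sum>s = 1..n. cof v 0 s * D s e) = 0"
    unfolding sum_distrib_left using D_e by (intro sum.neutral) (metis mult.left_commute mult_zero_right)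
  moreover have "(\<Sum>s = 1..n. cof v 0 s * D s (a * a')) =
      a * (\<Sum>s = 1..n. cof v 0 s * D s a') + a' * (\<Sum>s = 1..n. cof v 0 s * D s a)"
    unfolding sum_distrib_left sum.distrib[symmetric]
    by (intro sum.cong refl) (simp add: D_mult algebra_simps)
  ultimately show ?thesis
    unfolding jac_update[OF le0] sum_atMost_eq_0_plus
    by (simp add: E_eq_D distrib_left mult.left_commute[of _ "cof v 0 0"])
qed

end

section \<open>Adjoining a unit\<close>

primrec nat_smul :: "nat \<Rightarrow> 'a::ab_group_add \<Rightarrow> 'a" where
  "nat_smul 0 a = 0"
| "nat_smul (Suc k) a = nat_smul k a + a"

text \<open>At least one of the two terms is zero, since \<open>nat\<close> sends negative integers
  to 0.\<close>

definition int_smul :: "int \<Rightarrow> 'a::ab_group_add \<Rightarrow> 'a" where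
  "int_smul m a = nat_smul (nat m) a - nat_smul (nat (- m)) a"

lemma int_smul_0 [simp]: "int_smul 0 a = 0"
  by (simp add: int_smul_def)

lemma int_smul_add_1: "int_smul (m + 1) a = int_smul m a + a"
proof (cases "m \<ge> 0")
  case True
  then have "nat (m + 1) = Suc (nat m)"
    by simp
  with True show ?thesis
    by (simp add: int_smul_def)
next
  case False
  then have "nat (- m) = Suc (nat (- (m + 1)))"
    by simp
  with False show ?thesis
    by (simp add: int_smul_def)
qed

lemma int_smul_diff_1: "int_smul (m - 1) a = int_smul m a - a"
  using int_smul_add_1[of "m - 1" a] by simp

lemma int_smul_1 [simp]: "int_smul 1 a = a"
  using int_smul_add_1[of 0 a] by simp

text \<open>Induction from 0 in both directions; applied below to multiplications and to
  derivations.\<close>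

lemma additive_int_smul:
  assumes "additive f"
  shows "f (int_smul m a) = int_smul m (f a)"
proof -
  interpret additive f by fact
  show ?thesis
    by (induction m rule: int_induct[of _ 0]) (simp_all add: zero add diff int_smul_add_1 int_smul_diff_1)
qed

lemma int_smul_add_left: "int_smul (m + k) a = int_smul m a + int_smul k a"
proof (induction k rule: int_induct[of _ 0])
  case (step1 k)
  then show ?case
    using int_smul_add_1[of "m + k" a] by (simp add: int_smul_add_1 add.assoc)
next
  case (step2 k)
  then show ?case
    using int_smul_diff_1[of "m + k" a] by (simp add: int_smul_diff_1 algebra_simps)
qed simp

lemma int_smul_add_right: "int_smul m (a + b) = int_smul m a + int_smul m b"
  by (induction m rule: int_induct[of _ 0]) (simp_all add: int_smul_add_1 int_smul_diff_1 algebra_simps)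

lemma int_smul_zero_right [simp]: "int_smul m 0 = 0"
  using int_smul_add_right[of m 0 0] by simp

lemma int_smul_mult: "int_smul (m * k) a = int_smul m (int_smul k a)"
proof (induction m rule: int_induct[of _ 0])
  case (step1 m)
  then show ?case
    by (simp add: distrib_right int_smul_add_left int_smul_add_1)
next
  case (step2 m)
  have "int_smul (m * k) a = int_smul ((m - 1) * k) a + int_smul k a"
    using int_smul_add_left[of "(m - 1) * k" k a] by (simp add: algebra_simps)
  with step2 show ?case
    by (simp add: int_smul_diff_1 algebra_simps)
qed simp

lemma int_smul_times_left: "int_smul m a * b = int_smul m (a * b)" for a b :: "'a::comm_ring"
  by (rule additive_int_smul[where f = "\<lambda>x. x * b"]) (simp add: additive_def distrib_right)

lemma int_smul_times_right: "b * int_smul m a = int_smul m (b * a)" for a b :: "'a::comm_ring"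
  by (rule additive_int_smul[where f = "\<lambda>x. b * x"]) (simp add: additive_def distrib_left)

text \<open>\<open>Adj m a\<close> stands for m 1 + a. Adjoining integers rather than elements of K
  makes the ring depend on U alone, not on its scalar action.\<close>

datatype 'a unitization = Adj (int_part: int) (ring_part: 'a)

instantiation unitization :: (comm_ring) comm_ring_1
begin

definition "0 = Adj 0 0"

definition "1 = Adj 1 0"

definition "x + y = Adj (int_part x + int_part y) (ring_part x + ring_part y)"

definition "- x = Adj (- int_part x) (- ring_part x)"

definition "x - y = Adj (int_part x - int_part y) (ring_part x - ring_part y)"

definition "x * y = Adj (int_part x * int_part y)
  (int_smul (int_part x) (ring_part y) + int_smul (int_part y) (ring_part x) + ring_part x * ring_part y)"

instance
proof
  fix x y z :: "'a unitization"
  show "x * y * z = x * (y * z)"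
    by (simp add: times_unitization_def int_smul_add_right int_smul_mult[symmetric]
        int_smul_times_left int_smul_times_right distrib_left distrib_right mult_ac add_ac)
  show "(x + y) * z = x * z + y * z"
    by (simp add: times_unitization_def plus_unitization_def int_smul_add_right int_smul_add_left
        distrib_left distrib_right mult_ac add_ac)
qed (simp_all add: zero_unitization_def one_unitization_def plus_unitization_def uminus_unitization_def
    minus_unitization_def times_unitization_def add_ac mult_ac)

end

section \<open>The embedding of U and the extended derivations\<close>

lemma Adj_0_eq_iff [simp]: "Adj 0 x = 0 \<longleftrightarrow> x = 0"
  by (simp add: zero_unitization_def)

lemma Adj_0_add: "Adj 0 (x + y) = Adj 0 x + Adj 0 y"
  by (simp add: plus_unitization_def)

lemma Adj_0_mult: "Adj 0 (x * y) = Adj 0 x * Adj 0 y"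
  by (simp add: times_unitization_def)

interpretation Adj_0: additive "Adj 0"
  by unfold_locales (rule Adj_0_add)

definition lift_derivation :: "('a::comm_ring \<Rightarrow> 'a) \<Rightarrow> 'a unitization \<Rightarrow> 'a unitization" where
  "lift_derivation d x = Adj 0 (d (ring_part x))"

lemma lift_derivation_Adj_0 [simp]: "lift_derivation d (Adj m x) = Adj 0 (d x)"
  by (simp add: lift_derivation_def)

lemma lift_derivation_add:
  assumes "additive d"
  shows "lift_derivation d (x + y) = lift_derivation d x + lift_derivation d y"
  using additive.add[OF assms] by (simp add: lift_derivation_def plus_unitization_def)

lemma lift_derivation_mult:
  assumes "additive d" "\<And>x y. d (x * y) = d x * y + x * d y"
  shows "lift_derivation d (x * y) = lift_derivation d x * y + x * lift_derivation d y"
  using additive.add[OF assms(1)] additive_int_smul[OF assms(1)] assms(2)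
  by (simp add: lift_derivation_def plus_unitization_def times_unitization_def add_ac)

text \<open>\<open>Adj 0\<close> respects sums, negatives and products but not units. The Leibniz
  formula over \<open>prod_upto\<close> has no empty products, so this suffices.\<close>

lemma Adj_0_det_upto: "Adj 0 (det_upto n M) = det_upto n (\<lambda>i j. Adj 0 (M i j))"
proof -
  have "Adj 0 (prod_upto f m) = prod_upto (\<lambda>i. Adj 0 (f i)) m" for f :: "nat \<Rightarrow> 'a" and m
    by (induction m) (simp_all add: Adj_0_mult)
  then show ?thesis
    unfolding det_upto_def Adj_0.sum by (intro sum.cong) (simp_all add: Adj_0.minus)
qed

section \<open>Linearity without a unit\<close>

lemma prod_upto_add:
  assumes "k \<le> n" "f k = g k + h k" "\<And>i. i \<noteq> k \<Longrightarrow> f i = g i" "\<And>i. i \<noteq> k \<Longrightarrow> f i = h i"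
  shows "prod_upto f n = prod_upto g n + prod_upto h n"
  using assms(1)
proof (induction n)
  case 0
  then show ?case using assms(2) by simp
next
  case (Suc n)
  show ?case
  proof (cases "k = Suc n")
    case True
    have "prod_upto f m = prod_upto g m" "prod_upto f m = prod_upto h m" if "m < k" for m
      using that assms(3,4) by (induction m) auto
    with True assms(2) show ?thesis
      by (simp add: distrib_left)
  next
    case False
    then show ?thesis
      using Suc assms(3,4)[of "Suc n"] by (simp add: distrib_right)
  qed
qed

context comm_algebra
begin

lemma scale_mult_right: "y * scale c x = scale c (y * x)"
  using scale_mult_left[of c x y] by (simp add: mult.commute)

lemma prod_upto_scale:
  assumes "k \<le> n" "f k = scale c (g k)" "\<And>i. i \<noteq> k \<Longrightarrow> f i = g i"
  shows "prod_upto f n = scale c (prod_upto g n)"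
  using assms(1)
proof (induction n)
  case 0
  then show ?case using assms(2) by simp
next
  case (Suc n)
  show ?case
  proof (cases "k = Suc n")
    case True
    have "prod_upto f m = prod_upto g m" if "m < k" for m
      using that assms(3) by (induction m) auto
    with True assms(2) show ?thesis
      by (simp add: scale_mult_right)
  next
    case False
    then show ?thesis
      using Suc assms(3)[of "Suc n"] by (simp add: scale_mult_left)
  qed
qed

text \<open>Scalars of K do not act on the unitization, so linearity is shown in U itself: each
  permutation meets column \<open>k\<close> in exactly one row, and each product is linear in that
  factor.\<close>

lemma linear_det_upto_column:
  assumes k: "k \<le> n" and lin: "\<And>i. i \<le> n \<Longrightarrow> Vector_Spaces.linear scale scale (w i)"
  shows "Vector_Spaces.linear scale scale (\<lambda>x. det_upto n (\<lambda>i j. if j = k then w i x else M i j))"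
proof -
  let ?P = "\<lambda>x p. prod_upto (\<lambda>i. if p i = k then w i x else M i (p i)) n"
  have *: "?P (x + y) p = ?P x p + ?P y p \<and> ?P (scale c x) p = scale c (?P x p)" if p: "p permutes {..n}" for x y c p
  proof -
    obtain l where l: "p l = k" "l \<le> n"
      using permutes_image[OF p] k by (metis atMost_iff imageE)
    then have "p i = k \<longleftrightarrow> i = l" for i
      using permutes_inj[OF p] by (metis injD)
    then show ?thesis
      using lin[OF l(2)] l(2)
      by (auto simp: Vector_Spaces.linear_iff intro!: prod_upto_add[of l] prod_upto_scale[of l])
  qed
  show ?thesis
    unfolding det_upto_def Vector_Spaces.linear_iff sum.distrib[symmetric] scale_sum_right
    by (intro conjI allI vector_space_axioms sum.cong refl) (simp_all add: *)
qed

end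

section \<open>Transfer of the identities to U\<close>

theorem corollary6p4:
  fixes scale :: "'k::field_char_0 \<Rightarrow> 'a::comm_ring \<Rightarrow> 'a"
    and D :: "nat \<Rightarrow> 'a \<Rightarrow> 'a"
    and n :: nat
  assumes n: "n \<ge> 1"
    and algebra: "comm_algebra scale"
    and derivations: "\<And>i. i \<in> {1..n} \<Longrightarrow> derivation scale (D i)"
    and commuting: "\<And>i j x. i \<in> {1..n} \<Longrightarrow> j \<in> {1..n} \<Longrightarrow> D i (D j x) = D j (D i x)"
  shows "m_Lie_algebra scale (n + 1) (omega_tilde n D) \<and>
    (\<forall>us vs. length us = n \<longrightarrow> length vs = n + 2 \<longrightarrow>
       (\<Sum>i = 1..n + 2. scale ((-1) ^ i)
          (omega_tilde n D (us @ [vs ! (i - 1)]) *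
           omega_tilde n D (take (i - 1) vs @ drop i vs))) = 0) \<and>
    (\<forall>e. (\<forall>x. e * x = x) \<longrightarrow>
       (\<forall>u u' us. length us = n \<longrightarrow>
          omega_tilde n D ((u * u') # us) - u * omega_tilde n D (u' # us)
            - u' * omega_tilde n D (u # us)
          = - ((u * u') * omega_tilde n D (e # us))))"
proof -
  interpret comm_algebra scale
    by (rule algebra)
  let ?w = "omega_tilde n D"
  have linear: "Vector_Spaces.linear scale scale (D i)" if "i \<in> {1..n}" for i
    using derivations[OF that] by (simp add: derivation_def)
  have additive: "additive (D i)" if "i \<in> {1..n}" for i
    using linear[OF that] by (simp add: additive_def Vector_Spaces.linear_iff)
  interpret U: commuting_derivations n "\<lambda>i. lift_derivation (D i)"
  proof unfold_locales
    fix i j x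
    assume "i \<in> {1..n}" "j \<in> {1..n}"
    then show "lift_derivation (D i) (lift_derivation (D j) x) = lift_derivation (D j) (lift_derivation (D i) x)"
      by (simp add: lift_derivation_def commuting)
  qed (use derivations additive in
      \<open>auto simp: derivation_def intro!: lift_derivation_add lift_derivation_mult\<close>)
  \<comment> \<open>Any \<open>v\<close> agreeing with the list up to index n is allowed, so list
    operations can be matched with function updates. Equations return to U because
    \<open>Adj 0\<close> is injective.\<close>
  have lift: "Adj 0 (?w us) = U.jac v" if "\<And>j. j \<le> n \<Longrightarrow> v j = Adj 0 (us ! j)" for us v
  proof -
    have "Adj 0 (?w us) = U.jac (\<lambda>j. Adj 0 (us ! j))"
      unfolding omega_tilde_def Adj_0_det_upto U.jac_def by (intro det_upto_cong) (simp add: U.E_def)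
    also have "\<dots> = U.jac v"
      by (intro U.jac_cong) (simp add: that)
    finally show ?thesis .
  qed
  \<comment> \<open>The only scalars to be carried into the unitization are signs.\<close>
  have scale_neg: "scale (- 1) x = - x" for x
    by (simp add: scale_minus_left)
  have scale_sign: "Adj 0 (scale (of_int (sign p)) x) = of_int (sign p) * Adj 0 x" for p :: "nat \<Rightarrow> nat" and x
    by (cases p rule: sign_cases) (simp_all add: scale_neg Adj_0.minus)
  have scale_power: "Adj 0 (scale ((- 1) ^ i) x) = (- 1) ^ i * Adj 0 x" for i x
    by (cases "even i") (simp_all add: scale_neg Adj_0.minus)
  have multilinear: "multilinear scale (n + 1) ?w"
    unfolding multilinear_def
  proof (intro allI impI)
    fix xs :: "'a list" and k
    assume xs: "length xs = n + 1" "k < n + 1"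
    have "?w (xs[k := x]) =
        det_upto n (\<lambda>i j. if j = k then if i = 0 then x else D i x else if i = 0 then xs ! j else D i (xs ! j))" for x
      unfolding omega_tilde_def using xs by (intro det_upto_cong) (auto simp: nth_list_update)
    moreover have "Vector_Spaces.linear scale scale (\<lambda>x. if i = 0 then x else D i x)" if "i \<le> n" for i
      using that linear[of i] linear_ident by (cases "i = 0") auto
    ultimately show "Vector_Spaces.linear scale scale (\<lambda>x. ?w (xs[k := x]))"
      using xs(2) by (simp add: linear_det_upto_column)
  qed
  have skew: "skew_symmetric scale (n + 1) ?w"
    unfolding skew_symmetric_def
  proof (intro allI impI)
    fix xs :: "'a list" and p
    assume xs: "length xs = n + 1" "p permutes {..<n + 1}"
    then have p: "p permutes {..n}"
      by (simp add: lessThan_Suc_atMost)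
    have "Adj 0 (?w (permute_list p xs)) = U.jac ((\<lambda>j. Adj 0 (xs ! j)) \<circ> p)"
      by (intro lift) (use xs in \<open>simp add: permute_list_nth\<close>)
    also have "\<dots> = Adj 0 (scale (of_int (sign p)) (?w xs))"
      unfolding U.jac_permute[OF p] scale_sign by (subst lift) (rule refl, rule refl)
    finally show "?w (permute_list p xs) = scale (of_int (sign p)) (?w xs)"
      by simp
  qed
  have Filippov: "?w (us @ [?w vs]) = (\<Sum>i<n + 1. ?w (vs[i := ?w (us @ [vs ! i])]))"
    if "length us + 1 = n + 1" "length vs = n + 1" for us vs
  proof -
    \<comment> \<open>Index n lies beyond \<open>us\<close>; that value of \<open>?u\<close> is
      always overwritten.\<close>
    let ?u = "\<lambda>j. Adj 0 (us ! j)" and ?v = "\<lambda>j. Adj 0 (vs ! j)"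
    have app: "Adj 0 (?w (us @ [x])) = U.jac (?u(n := Adj 0 x))" for x
      by (intro lift) (use that in \<open>auto simp: nth_append\<close>)
    have "Adj 0 (?w (us @ [?w vs])) = U.jac (?u(n := U.jac ?v))"
      using lift[of ?v vs] by (simp add: app)
    also have "\<dots> = (\<Sum>k\<le>n. U.jac (?v(k := Adj 0 (?w (us @ [vs ! k])))))"
      by (simp add: U.jac_Filippov app)
    also have "\<dots> = (\<Sum>k\<le>n. Adj 0 (?w (vs[k := ?w (us @ [vs ! k])])))"
      by (intro sum.cong refl lift[symmetric]) (use that in \<open>auto simp: nth_list_update\<close>)
    finally show ?thesis
      by (simp add: Adj_0.sum[symmetric] lessThan_Suc_atMost)
  qed
  have quadratic: "(\<Sum>i = 1..n + 2. scale ((-1) ^ i)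
      (?w (us @ [vs ! (i - 1)]) * ?w (take (i - 1) vs @ drop i vs))) = 0"
    if "length us = n" "length vs = n + 2" for us vs
  proof -
    let ?u = "\<lambda>j. Adj 0 (us ! j)" and ?v = "\<lambda>j. Adj 0 (vs ! j)"
    have app: "Adj 0 (?w (us @ [x])) = U.jac (?u(n := Adj 0 x))" for x
      by (intro lift) (use that in \<open>auto simp: nth_append\<close>)
    have del: "Adj 0 (?w (take j vs @ drop (Suc j) vs)) = U.jac (\<lambda>c. ?v (if c < j then c else Suc c))"
      if "j \<le> Suc n" for j
      by (intro lift) (use that \<open>length vs = n + 2\<close> in \<open>auto simp: nth_append min_def\<close>)
    \<comment> \<open>Passing to indices from 0 turns the sign into \<open>(-1) ^ Suc j\<close>,
      which flips the whole sum.\<close>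
    have "{1..n + 2} = Suc ` {..Suc n}"
      by (auto simp: image_Suc_atMost)
    then have "Adj 0 (\<Sum>i = 1..n + 2. scale ((-1) ^ i)
        (?w (us @ [vs ! (i - 1)]) * ?w (take (i - 1) vs @ drop i vs))) =
        (\<Sum>j\<le>Suc n. (-1) ^ Suc j * Adj 0 (?w (us @ [vs ! j]) * ?w (take j vs @ drop (Suc j) vs)))"
      by (simp add: Adj_0.sum scale_power sum.reindex del: sum.atMost_Suc power_Suc)
    also have "\<dots> = - (\<Sum>j\<le>Suc n. (-1) ^ j * (U.jac (?u(n := ?v j)) * U.jac (\<lambda>c. ?v (if c < j then c else Suc c))))"
      unfolding sum_negf[symmetric] by (intro sum.cong refl) (simp add: Adj_0_mult app del)
    also have "\<dots> = 0"
      unfolding U.jac_quadratic[of ?u ?v] by simp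
    finally show ?thesis
      by simp
  qed
  have product: "?w ((a * a') # us) - a * ?w (a' # us) - a' * ?w (a # us) = - ((a * a') * ?w (e # us))"
    if e: "\<And>x. e * x = x" and "length us = n" for e a a' us
  proof -
    \<comment> \<open>At index 0 the truncated subtraction yields \<open>us ! 0\<close>, which the
      update at 0 replaces.\<close>
    let ?v = "\<lambda>j. Adj 0 (us ! (j - 1))"
    have cons: "Adj 0 (?w (x # us)) = U.jac (?v(0 := Adj 0 x))" for x
      by (intro lift) (auto simp: nth_Cons split: nat.split)
    have "Adj 0 (?w ((a * a') # us) - a * ?w (a' # us) - a' * ?w (a # us)) =
        Adj 0 (- ((a * a') * ?w (e # us)))"
      unfolding Adj_0.diff Adj_0.minus Adj_0_mult cons
      by (rule U.jac_mult) (auto simp: Adj_0_mult[symmetric] e)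
    then show ?thesis
      by simp
  qed
  show ?thesis
    unfolding m_Lie_algebra_def
    using vector_space_axioms multilinear skew Filippov quadratic product by blast
qed

end
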